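(* Let $m$ be a positive integer, $F=\mathbb{F}_{2^m}$, let $b\in F$ and put $\xi=b^4+b+1$. If $\xi\notin\{0,1\}$, then \[ K(\xi^4+\xi^3)\equiv\begin{cases}3\pmod{12}, & \text{if } m \text{ is odd},\\ 7\pmod{12}, & \text{if } m \text{ is even}.\end{cases} \]
   Context: $\mathrm{Tr}$ denotes the absolute trace from $F=\mathbb{F}_{2^m}$ to $\mathbb{F}_2$. For $a\in F\setminus\{0\}$, the Kloosterman sum is $K(a)=\sum_{x\in F\setminus\{0\}}(-1)^{\mathrm{Tr}(ax+1/x)}$. *)

theory Defs
  imports "HOL-Number_Theory.Number_Theory" "HOL-Library.Cardinality"
begin

text \<open>
  The field with \<open>2 ^ m\<close> elements is a type \<open>'a :: {field, finite}\<close> with \<open>CARD('a) = 2 ^ m\<close>.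
  Its prime field is the subset \<open>{0, 1}\<close>, so the absolute trace
  \<open>x + x\<^sup>2 + x\<^sup>4 + \<dots> + x\<^bsup>2^(m-1)\<^esup>\<close> is given as an element of \<open>'a\<close>; the lemma
  \<open>abs_trace_in_prime_field\<close> below shows that it lies in \<open>{0, 1}\<close>.
\<close>

definition abs_trace :: "nat \<Rightarrow> 'a::field \<Rightarrow> 'a" where
  "abs_trace m x = (\<Sum>i<m. x ^ (2 ^ i))"

text \<open>\<open>(-1)\<^sup>t\<close> for \<open>t\<close> in the prime field \<open>{0, 1}\<close> of a field of characteristic 2.\<close>

definition neg_one_pow :: "'a::field \<Rightarrow> int" where
  "neg_one_pow t = (if t = 0 then 1 else - 1)"

definition kloosterman :: "nat \<Rightarrow> 'a::{field, finite} \<Rightarrow> int" where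
  "kloosterman m a = (\<Sum>x\<in>UNIV - {0}. neg_one_pow (abs_trace m (a * x + 1 / x)))"

lemma finite_field_power_card:
  fixes x :: "'a::{field, finite}"
  shows "x ^ CARD('a) = x"
proof (cases "x = 0")
  case True
  then show ?thesis by simp
next
  case False
  let ?U = "UNIV - {0 :: 'a}"
  have "bij_betw ((*) x) ?U ?U"
    by (rule bij_betwI[where g = "\<lambda>y. y / x"]) (use False in auto)
  then have "(\<Prod>y\<in>?U. y) = (\<Prod>y\<in>?U. x * y)"
    by (rule prod.reindex_bij_betw[symmetric])
  also have "\<dots> = x ^ card ?U * (\<Prod>y\<in>?U. y)"
    by (simp add: prod.distrib)
  finally have "x ^ card ?U = 1"
    by simp
  moreover have "CARD('a) = Suc (card ?U)"
    by (rule card_Suc_Diff1[symmetric]) simp_all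
  ultimately show ?thesis
    by (metis mult.right_neutral power_Suc)
qed

lemma abs_trace_in_prime_field:
  fixes x :: "'a::{field, finite}"
  assumes "CARD('a) = 2 ^ m"
  shows "abs_trace m x \<in> {0, 1}"
proof -
  have prm: "prime CHAR('a)"
    by (simp add: prime_CHAR_semidom finite_imp_CHAR_pos)
  have "CHAR('a) dvd 2 ^ m"
    using CHAR_dvd_CARD[where ?'a = 'a] assms by simp
  with prm have char: "CHAR('a) = 2"
    by (metis prime_dvd_power primes_dvd_imp_eq two_is_prime_nat)
  have "abs_trace m x ^ 2 = (\<Sum>i<m. (x ^ (2 ^ i)) ^ 2)"
    unfolding abs_trace_def by (rule freshmans_dream_sum[OF prm char[symmetric]])
  also have "\<dots> = (\<Sum>i<m. x ^ (2 ^ Suc i))"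
    by (simp only: power_Suc2 power_mult)
  also have "\<dots> = abs_trace m x + x ^ (2 ^ m) - x"
    unfolding abs_trace_def using sum.lessThan_Suc_shift[of "\<lambda>i. x ^ (2 ^ i)" m] by simp
  also have "\<dots> = abs_trace m x"
    by (simp only: finite_field_power_card[of x, unfolded assms] add_diff_cancel_right')
  finally have "abs_trace m x * (abs_trace m x - 1) = 0"
    by (simp add: power2_eq_square algebra_simps)
  then show ?thesis
    by simp
qed

end

theory Submission
  imports Defs "HOL-Computational_Algebra.Polynomial"
begin

text \<open>
  Write \<open>\<chi>(x) = (-1)\<^bsup>Tr x\<^esup>\<close> and let \<open>a = \<xi>\<^sup>4 + \<xi>\<^sup>3\<close>. Modulo 4, the involution
  \<open>x \<mapsto> 1 / (a x)\<close> preserves \<open>a x + 1 / x\<close> and has a single fixed point, at which the trace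
  vanishes, so the trace vanishes at an odd number of \<open>x\<close>. Modulo 3, the points of the curve
  \<open>y z w = \<xi>\<^sup>2\<close>, \<open>y + z + w = 1\<close> are permuted cyclically without fixed points, because
  \<open>\<xi>\<^sup>2 \<noteq> 1\<close>. Solving the quadratic equation for \<open>z\<close> shows that their number is
  \<open>2\<^sup>m - 2 + \<chi>(\<xi>) K(a)\<close>, and \<open>\<chi>(\<xi>) = \<chi>(1) = (-1)\<^sup>m\<close>.
\<close>

section \<open>Orbit counting for maps of order three and two\<close>

text \<open>Induction removes one orbit \<open>{x, f x, f (f x)}\<close> at a time. Its elements are
  distinct because \<open>f\<close> has no fixed point on \<open>S\<close>, and the rest stays
  closed under \<open>f\<close> because applying \<open>f\<close> twice more to \<open>f y\<close>
  leads back to \<open>y\<close>.\<close>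

lemma three_dvd_card_if_no_fixed_point:
  assumes "finite S"
    and "\<And>x. x \<in> S \<Longrightarrow> f x \<in> S"
    and "\<And>x. x \<in> S \<Longrightarrow> f (f (f x)) = x"
    and "\<And>x. x \<in> S \<Longrightarrow> f x \<noteq> x"
  shows "3 dvd card S"
  using assms
proof (induction S rule: finite_psubset_induct)
  case (psubset S)
  show ?case
  proof (cases "S = {}")
    case False
    then obtain x where x: "x \<in> S" by blast
    let ?O = "{x, f x, f (f x)}"
    have O: "?O \<subseteq> S" using x psubset.prems(1) by blast
    have c: "card ?O = 3"
      using psubset.prems(2,3) x O by (auto simp: card_insert_if) (metis insert_subset)+
    have cl: "f y \<in> S - ?O" if "y \<in> S - ?O" for y
    proof -
      have "f (f (f y)) = y" "f y \<in> S" using that psubset.prems by blast+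
      moreover have "f (f (f x)) = x" using x psubset.prems by blast
      ultimately show ?thesis using that by auto
    qed
    have "3 dvd card (S - ?O)"
      by (rule psubset.IH) (use x cl psubset.prems(2,3) in auto)
    moreover have "card S = card (S - ?O) + 3"
      using card_Diff_subset[OF _ O] card_mono[OF psubset.hyps O] c by simp
    ultimately show ?thesis by simp
  qed simp
qed

lemma even_card_if_no_fixed_point:
  assumes "finite S"
    and "\<And>x. x \<in> S \<Longrightarrow> f x \<in> S"
    and "\<And>x. x \<in> S \<Longrightarrow> f (f x) = x"
    and "\<And>x. x \<in> S \<Longrightarrow> f x \<noteq> x"
  shows "even (card S)"
  using assms
proof (induction S rule: finite_psubset_induct)
  case (psubset S)
  show ?case
  proof (cases "S = {}")
    case False
    then obtain x where x: "x \<in> S" by blast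
    let ?O = "{x, f x}"
    have O: "?O \<subseteq> S" using x psubset.prems(1) by blast
    have c: "card ?O = 2"
      using psubset.prems(3)[OF x] by auto
    have cl: "f y \<in> S - ?O" if "y \<in> S - ?O" for y
    proof -
      have "f (f y) = y" "f y \<in> S" using that psubset.prems by blast+
      moreover have "f (f x) = x" using x psubset.prems by blast
      ultimately show ?thesis using that by auto
    qed
    have "even (card (S - ?O))"
      by (rule psubset.IH) (use x cl psubset.prems(2,3) in auto)
    moreover have "card S = card (S - ?O) + 2"
      using card_Diff_subset[OF _ O] card_mono[OF psubset.hyps O] c by simp
    ultimately show ?thesis by simp
  qed simp
qed

section \<open>Arithmetic in characteristic 2\<close>

lemma CHAR_eq_2_if_card_power_2:
  assumes "CARD('a::{field, finite}) = 2 ^ m"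
  shows "CHAR('a) = 2"
proof -
  have "prime CHAR('a)"
    by (simp add: prime_CHAR_semidom finite_imp_CHAR_pos)
  moreover have "CHAR('a) dvd 2 ^ m"
    using CHAR_dvd_CARD[where ?'a = 'a] assms by simp
  ultimately show ?thesis
    by (metis prime_dvd_power primes_dvd_imp_eq two_is_prime_nat)
qed

lemma add_self_char_2:
  fixes x :: "'a::{field, finite}"
  assumes "CARD('a) = 2 ^ m"
  shows "x + x = 0"
proof -
  have "(2 :: 'a) = 0"
    using of_nat_CHAR[where ?'a = 'a] CHAR_eq_2_if_card_power_2[OF assms] by simp
  then show ?thesis by (metis mult_2 mult_zero_left)
qed

lemma add_eq_0_iff_char_2:
  fixes x y :: "'a::{field, finite}"
  assumes "CARD('a) = 2 ^ m"
  shows "x + y = 0 \<longleftrightarrow> x = y"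
  using add_self_char_2[OF assms] by (metis add_right_imp_eq)

lemma add_power2_char_2:
  fixes x y :: "'a::{field, finite}"
  assumes "CARD('a) = 2 ^ m"
  shows "(x + y) ^ 2 = x ^ 2 + y ^ 2"
  by (rule freshmans_dream) (simp_all add: CHAR_eq_2_if_card_power_2[OF assms])

text \<open>Squaring is additive with trivial kernel, hence injective, and finiteness makes it
  surjective. It supplies unique square roots.\<close>

lemma bij_power2_char_2:
  assumes "CARD('a::{field, finite}) = 2 ^ m"
  shows "bij (\<lambda>x::'a. x ^ 2)"
proof -
  have "inj (\<lambda>x::'a. x ^ 2)"
  proof (rule injI)
    fix x y :: 'a assume "x ^ 2 = y ^ 2"
    then have "(x + y) ^ 2 = 0"
      using add_power2_char_2[OF assms] add_self_char_2[OF assms] by metis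
    then show "x = y" using add_eq_0_iff_char_2[OF assms] by simp
  qed
  then show ?thesis by (simp add: bij_def finite_UNIV_inj_surj)
qed

section \<open>The absolute trace and its additive character\<close>

lemma abs_trace_add:
  fixes x y :: "'a::{field, finite}"
  assumes "CARD('a) = 2 ^ m"
  shows "abs_trace n (x + y) = abs_trace n x + abs_trace n y"
proof -
  have "(x + y) ^ (2 ^ i) = x ^ (2 ^ i) + y ^ (2 ^ i)" for i
    by (rule freshmans_dream')
      (simp_all add: CHAR_eq_2_if_card_power_2[OF assms])
  then show ?thesis unfolding abs_trace_def by (simp add: sum.distrib)
qed

text \<open>Squaring shifts the sum by one index; the new top term \<open>x ^ (2 ^ m)\<close> is the
  lost term \<open>x\<close>.\<close>

lemma abs_trace_power2:
  fixes x :: "'a::{field, finite}"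
  assumes "CARD('a) = 2 ^ m"
  shows "abs_trace m (x ^ 2) = abs_trace m x"
proof -
  have "abs_trace m (x ^ 2) = (\<Sum>i<m. x ^ (2 ^ Suc i))"
    unfolding abs_trace_def by (simp add: power_mult)
  also have "\<dots> = abs_trace m x + x ^ (2 ^ m) - x"
    unfolding abs_trace_def using sum.lessThan_Suc_shift[of "\<lambda>i. x ^ (2 ^ i)" m] by simp
  also have "\<dots> = abs_trace m x"
    using finite_field_power_card[of x] assms by simp
  finally show ?thesis .
qed

definition trace_char :: "nat \<Rightarrow> 'a::field \<Rightarrow> int" where
  "trace_char m x = neg_one_pow (abs_trace m x)"

lemma trace_char_add:
  fixes x y :: "'a::{field, finite}"
  assumes "CARD('a) = 2 ^ m"
  shows "trace_char m (x + y) = trace_char m x * trace_char m y"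
  using abs_trace_in_prime_field[OF assms, of x] abs_trace_in_prime_field[OF assms, of y]
    add_self_char_2[OF assms, of 1]
  by (auto simp: trace_char_def neg_one_pow_def abs_trace_add[OF assms])

lemma trace_char_power2:
  fixes x :: "'a::{field, finite}"
  assumes "CARD('a) = 2 ^ m"
  shows "trace_char m (x ^ 2) = trace_char m x"
  by (simp add: trace_char_def abs_trace_power2[OF assms])

lemma trace_char_mult_self: "trace_char m x * trace_char m x = 1"
  by (simp add: trace_char_def neg_one_pow_def)

lemma trace_char_1:
  assumes "CARD('a::{field, finite}) = 2 ^ m"
  shows "trace_char m (1 :: 'a) = (- 1) ^ m"
proof -
  have "(of_nat m :: 'a) = 0 \<longleftrightarrow> even m"
    using CHAR_eq_2_if_card_power_2[OF assms] by (simp add: of_nat_eq_0_iff_char_dvd)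
  then show ?thesis
    by (auto simp: trace_char_def neg_one_pow_def abs_trace_def)
qed

section \<open>Artin-Schreier equations\<close>

lemma card_abs_trace_eq_0_le:
  assumes "m > 0"
  shows "card {x :: 'a::{field, finite}. abs_trace m x = 0} \<le> 2 ^ (m - 1)"
proof -
  let ?p = "\<Sum>i<m. Polynomial.monom (1 :: 'a) (2 ^ i)"
  \<comment> \<open>Only the summand with \<open>i = 0\<close> contributes to the linear
    coefficient, so the trace polynomial is nonzero and the bound on its roots applies.\<close>
  have "Polynomial.coeff ?p 1 = (\<Sum>i<m. if i = 0 then 1 else 0)"
    unfolding Polynomial.coeff_sum by (rule sum.cong) auto
  then have "?p \<noteq> 0" using assms by (auto simp del: One_nat_def)
  moreover have "{x. abs_trace m x = 0} = {x. poly ?p x = 0}"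
    by (simp add: abs_trace_def poly_sum poly_monom)
  moreover have "Polynomial.degree ?p \<le> 2 ^ (m - 1)"
    by (rule degree_sum_le) (auto intro!: order.trans[OF Polynomial.degree_monom_le] power_increasing)
  ultimately show ?thesis
    using card_poly_roots_bound[of ?p] by simp
qed

lemma artin_schreier_fibre:
  fixes z :: "'a::{field, finite}"
  assumes "CARD('a) = 2 ^ m"
  shows "{u. u ^ 2 + u = z ^ 2 + z} = {z, z + 1}"
proof -
  have "u ^ 2 + u = z ^ 2 + z \<longleftrightarrow> u = z \<or> u = z + 1" for u
  proof -
    have "u ^ 2 + u = z ^ 2 + z \<longleftrightarrow> (u ^ 2 + u) + (z ^ 2 + z) = 0"
      by (simp only: add_eq_0_iff_char_2[OF assms])
    also have "(u ^ 2 + u) + (z ^ 2 + z) = (u + z) ^ 2 + (u + z)"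
      by (simp add: add_power2_char_2[OF assms] algebra_simps)
    also have "\<dots> = (u + z) * (u + (z + 1))"
      by (simp add: power2_eq_square algebra_simps)
    also have "\<dots> = 0 \<longleftrightarrow> u = z \<or> u = z + 1"
      by (simp only: mult_eq_0_iff add_eq_0_iff_char_2[OF assms])
    finally show ?thesis .
  qed
  then show ?thesis by auto
qed

text \<open>
  Additive Hilbert 90: \<open>u \<mapsto> u\<^sup>2 + u\<close> is two-to-one into the kernel of the trace, which has at
  most \<open>2\<^bsup>m-1\<^esup>\<close> elements, being the zero set of a polynomial of that degree.
\<close>

lemma range_artin_schreier:
  assumes "m > 0" and card: "CARD('a::{field, finite}) = 2 ^ m"
  shows "range (\<lambda>u::'a. u ^ 2 + u) = {x. abs_trace m x = 0}"
proof (rule card_subset_eq)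
  let ?R = "range (\<lambda>u::'a. u ^ 2 + u)"
  show sub: "?R \<subseteq> {x. abs_trace m x = 0}"
    by (auto simp: abs_trace_add[OF card] abs_trace_power2[OF card] add_self_char_2[OF card])
  have fib: "card {u::'a. u ^ 2 + u = e} = 2" if e: "e \<in> ?R" for e
  proof -
    obtain z where "e = z ^ 2 + z" using e by blast
    then show ?thesis by (simp add: artin_schreier_fibre[OF card])
  qed
  have "(UNIV :: 'a set) = (\<Union>e\<in>?R. {u. u ^ 2 + u = e})" by auto
  then have "CARD('a) = card (\<Union>e\<in>?R. {u::'a. u ^ 2 + u = e})" by simp
  also have "\<dots> = (\<Sum>e\<in>?R. card {u::'a. u ^ 2 + u = e})"
    by (rule card_UN_disjoint) auto
  also have "\<dots> = 2 * card ?R" using fib by simp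
  finally have "card ?R = 2 ^ (m - 1)" using assms by (cases m) auto
  then show "card ?R = card {x::'a. abs_trace m x = 0}"
    using card_abs_trace_eq_0_le[OF assms(1), where ?'a = 'a] card_mono[OF _ sub] by simp
qed simp

text \<open>The possible fibre sizes 2 and 0 match the character values 1 and -1. This converts
  point counts into character sums.\<close>

lemma card_artin_schreier:
  fixes e :: "'a::{field, finite}"
  assumes "m > 0" and card: "CARD('a) = 2 ^ m"
  shows "int (card {u. u ^ 2 + u = e}) = 1 + trace_char m e"
proof (cases "abs_trace m e = 0")
  case True
  then have "e \<in> range (\<lambda>u. u ^ 2 + u)" by (simp add: range_artin_schreier[OF assms])
  then obtain z where "e = z ^ 2 + z" by blast
  then show ?thesis
    using True by (simp add: artin_schreier_fibre[OF card] trace_char_def neg_one_pow_def)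
next
  case False
  then have "{u. u ^ 2 + u = e} = {}"
    using range_artin_schreier[OF assms] by blast
  then show ?thesis using False by (simp add: trace_char_def neg_one_pow_def)
qed

section \<open>The residue modulo 4\<close>

text \<open>The sum equals \<open>2 * card Z - (2 ^ m - 1)\<close>. As \<open>card Z\<close> is odd
  and 4 divides \<open>2 ^ m\<close> for \<open>m \<ge> 2\<close>, this is 2 + 1 modulo 4.\<close>

lemma kloosterman_mod_4:
  fixes a :: "'a::{field, finite}"
  assumes "m \<ge> 2" and card: "CARD('a) = 2 ^ m" and a: "a \<noteq> 0"
  shows "[kloosterman m a = 3] (mod 4)"
proof -
  let ?t = "\<lambda>x. abs_trace m (a * x + 1 / x)"
  define Z where "Z = {x. x \<noteq> 0 \<and> ?t x = 0}"
  \<comment> \<open>The fixed points of the involution solve \<open>a * x ^ 2 = 1\<close>, that is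
    \<open>(s * x) ^ 2 = 1\<close>, so \<open>1 / s\<close> is the only one.\<close>
  obtain s where s: "s ^ 2 = a"
    using bij_power2_char_2[OF card] unfolding bij_def surj_def by metis
  with a have s0: "s \<noteq> 0" by auto
  have "a * (1 / s) + 1 / (1 / s) = s + s" using s s0 by (auto simp: power2_eq_square)
  then have sZ: "1 / s \<in> Z"
    using s0 by (simp add: Z_def add_self_char_2[OF card] abs_trace_def power_0_left)
  have "even (card (Z - {1 / s}))"
  proof (rule even_card_if_no_fixed_point[where f = "\<lambda>x. 1 / (a * x)"])
    fix x assume x: "x \<in> Z - {1 / s}"
    then have x0: "x \<noteq> 0" by (simp add: Z_def)
    show "1 / (a * (1 / (a * x))) = x" using a x0 by simp
    have ne: "a * x ^ 2 \<noteq> 1"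
    proof
      assume "a * x ^ 2 = 1"
      then have "(s * x) ^ 2 = 1 ^ 2" by (simp add: s power_mult_distrib)
      then have "s * x = 1" using bij_power2_char_2[OF card] by (metis bij_def injD)
      then show False using x s0 by (auto simp: field_simps)
    qed
    then show "1 / (a * x) \<noteq> x" using a x0 by (auto simp: field_simps power2_eq_square)
    have "a * (1 / (a * x)) + 1 / (1 / (a * x)) = a * x + 1 / x"
      using a by (simp add: add.commute)
    then have "?t (1 / (a * x)) = 0" using x by (simp only:) (simp add: Z_def)
    moreover have "1 / (a * x) \<noteq> 1 / s"
    proof
      assume "1 / (a * x) = 1 / s"
      then have "a * x = s" using a x0 s0 by (simp add: field_simps)
      then have "a * x ^ 2 = s * x" "s * x = 1"
        using s s0 by (auto simp: power2_eq_square ac_simps)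
      then show False using ne by simp
    qed
    ultimately show "1 / (a * x) \<in> Z - {1 / s}" using a x0 by (simp only: Z_def) simp
  qed simp
  moreover have "card Z = Suc (card (Z - {1 / s}))"
    by (rule card_Suc_Diff1[symmetric]) (use sZ in simp_all)
  ultimately obtain k where k: "card Z = Suc (2 * k)" by (auto elim!: evenE)
  have "kloosterman m a = (\<Sum>x\<in>UNIV - {0}. 2 * of_bool (x \<in> Z) - 1)"
    unfolding kloosterman_def by (rule sum.cong) (auto simp: Z_def neg_one_pow_def)
  also have "\<dots> = 2 * (\<Sum>x\<in>UNIV - {0}. of_bool (x \<in> Z)) - int (card (UNIV - {0 :: 'a}))"
    by (simp only: sum_subtractf sum_distrib_left) simp
  also have "(\<Sum>x\<in>UNIV - {0}. of_bool (x \<in> Z)) = int (card Z)"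
  proof -
    have "(UNIV - {0}) \<inter> Z = Z" by (auto simp: Z_def)
    then show ?thesis
      using sum.inter_restrict[of "UNIV - {0}" "\<lambda>_. 1 :: int" Z] by (simp add: of_bool_def)
  qed
  also have "int (card (UNIV - {0 :: 'a})) = 2 ^ m - 1"
    by (simp add: card_Diff_singleton card of_nat_diff)
  finally have "kloosterman m a = 2 * int (card Z) - (2 ^ m - 1)" .
  moreover have "(2 :: int) ^ m = 4 * 2 ^ (m - 2)"
    using assms(1) by (auto dest!: le_Suc_ex simp: power_add)
  ultimately have "kloosterman m a - 3 = 4 * (int k - 2 ^ (m - 2))"
    using k by simp
  then show ?thesis by (simp add: cong_iff_dvd_diff)
qed

section \<open>The residue modulo 3: points on a cubic curve\<close>

text \<open>The substitution \<open>v = A * x\<close> turns \<open>A / v + B * v\<close> into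
  \<open>1 / x + A * B * x\<close>.\<close>

lemma kloosterman_rescale:
  fixes A B :: "'a::{field, finite}"
  assumes "A \<noteq> 0"
  shows "(\<Sum>v\<in>UNIV - {0}. trace_char m (A / v + B * v)) = kloosterman m (A * B)"
proof -
  have "bij_betw ((*) A) (UNIV - {0}) (UNIV - {0})"
    by (rule bij_betwI[where g = "\<lambda>y. y / A"]) (use assms in auto)
  then have "(\<Sum>v\<in>UNIV - {0}. trace_char m (A / v + B * v)) =
      (\<Sum>x\<in>UNIV - {0}. trace_char m (A / (A * x) + B * (A * x)))"
    by (rule sum.reindex_bij_betw[symmetric])
  also have "\<dots> = kloosterman m (A * B)"
    unfolding kloosterman_def trace_char_def using assms
    by (intro sum.cong) (auto simp: algebra_simps)
  finally show ?thesis .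
qed

text \<open>Substituting \<open>z = (y + 1) * u\<close> makes the quadratic in \<open>z\<close> an
  Artin-Schreier equation in \<open>u\<close>.\<close>

lemma card_cubic_fibre:
  fixes c y :: "'a::{field, finite}"
  assumes "m > 0" and card: "CARD('a) = 2 ^ m" and y: "y \<noteq> 0" "y \<noteq> 1"
  shows "int (card {z. y * z * (y + z + 1) = c}) = 1 + trace_char m (c / (y * (y + 1) ^ 2))"
proof -
  have y1: "y + 1 \<noteq> 0" using y add_eq_0_iff_char_2[OF card] by simp
  have "bij_betw ((*) (y + 1)) {u. u ^ 2 + u = c / (y * (y + 1) ^ 2)} {z. y * z * (y + z + 1) = c}"
  proof (rule bij_betwI[where g = "\<lambda>z. z / (y + 1)"])
    have key: "y * ((y + 1) * u) * (y + (y + 1) * u + 1) = y * (y + 1) ^ 2 * (u ^ 2 + u)" for u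
      by (simp add: power2_eq_square algebra_simps)
    have key': "y * ((y + 1) * u) * (y + (y + 1) * u + 1) = c
        \<longleftrightarrow> u ^ 2 + u = c / (y * (y + 1) ^ 2)" for u
      unfolding key using y y1 by (simp add: eq_divide_eq mult.commute)
    show "(*) (y + 1) \<in> {u. u ^ 2 + u = c / (y * (y + 1) ^ 2)} \<rightarrow> {z. y * z * (y + z + 1) = c}"
      using key' by blast
    show "(\<lambda>z. z / (y + 1)) \<in> {z. y * z * (y + z + 1) = c} \<rightarrow> {u. u ^ 2 + u = c / (y * (y + 1) ^ 2)}"
    proof
      fix z assume "z \<in> {z. y * z * (y + z + 1) = c}"
      then show "z / (y + 1) \<in> {u. u ^ 2 + u = c / (y * (y + 1) ^ 2)}"
        using key'[of "z / (y + 1)"] y1 by simp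
    qed
  qed (use y1 in auto)
  from bij_betw_same_card[OF this] show ?thesis
    by (simp only: card_artin_schreier[OF assms(1) card, symmetric])
qed

text \<open>Counting over \<open>y\<close> gives no point at 0, one at 1, and a character sum
  elsewhere. That sum becomes a Kloosterman sum lacking its term at \<open>v = 1\<close>, which
  costs \<open>trace_char m \<xi>\<close> squared, i.e. 1, and so cancels the point over
  \<open>y = 1\<close>.\<close>

lemma card_cubic:
  fixes \<xi> :: "'a::{field, finite}"
  assumes "m > 0" and card: "CARD('a) = 2 ^ m" and \<xi>: "\<xi> \<noteq> 0"
  shows "int (card {(y, z). y * z * (y + z + 1) = \<xi> ^ 2}) =
    2 ^ m - 2 + trace_char m \<xi> * kloosterman m (\<xi> ^ 4 + \<xi> ^ 3)"
proof -
  note self = add_self_char_2[OF card]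
  let ?F = "\<lambda>y. {z. y * z * (y + z + 1) = \<xi> ^ 2}"
  let ?g = "\<lambda>v. trace_char m (\<xi> ^ 2 / v + (\<xi> ^ 2 + \<xi>) * v)"
  have F0: "?F 0 = {}" using \<xi> by simp
  \<comment> \<open>At \<open>y = 1\<close> the equation degenerates to
    \<open>z ^ 2 = \<xi> ^ 2\<close>.\<close>
  have "?F 1 = {\<xi>}"
  proof -
    have "1 * z * (1 + z + 1) = z ^ 2" for z :: 'a
      using self[of 1] by (simp add: power2_eq_square add.commute add.left_commute)
    then show ?thesis using bij_power2_char_2[OF card] by (auto simp: bij_def dest: injD)
  qed
  then have F1: "card (?F 1) = 1" by simp
  have "{(y, z). y * z * (y + z + 1) = \<xi> ^ 2} = Sigma UNIV ?F" by auto
  then have "int (card {(y, z). y * z * (y + z + 1) = \<xi> ^ 2}) = (\<Sum>y\<in>UNIV. int (card (?F y)))"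
    by (simp add: card_SigmaI)
  also have "\<dots> = int (card (?F 0)) + (int (card (?F 1)) + (\<Sum>y\<in>UNIV - {0, 1}. int (card (?F y))))"
  proof -
    have U: "UNIV = insert 0 (insert 1 (UNIV - {0, 1 :: 'a}))" by auto
    have "(\<Sum>y\<in>UNIV. h y) = h 0 + (h 1 + (\<Sum>y\<in>UNIV - {0, 1}. h y))" for h :: "'a \<Rightarrow> int"
      by (subst U) simp
    then show ?thesis .
  qed
  also have "\<dots> = 1 + (\<Sum>y\<in>UNIV - {0, 1}. 1 + trace_char m (\<xi> ^ 2 / (y * (y + 1) ^ 2)))"
    using F0 F1 card_cubic_fibre[OF assms(1) card] by simp
  also have "\<dots> = 1 + int (card (UNIV - {0, 1 :: 'a}))
      + (\<Sum>y\<in>UNIV - {0, 1}. trace_char m (\<xi> ^ 2 / (y * (y + 1) ^ 2)))"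
    by (simp add: sum.distrib)
  also have "int (card (UNIV - {0, 1 :: 'a})) = 2 ^ m - 2"
  proof -
    have "card {0, 1 :: 'a} \<le> CARD('a)" by (rule card_mono) auto
    then show ?thesis by (simp add: card_Diff_subset card of_nat_diff)
  qed
  also have "(\<Sum>y\<in>UNIV - {0, 1}. trace_char m (\<xi> ^ 2 / (y * (y + 1) ^ 2))) =
      (\<Sum>v\<in>UNIV - {0, 1}. trace_char m \<xi> * ?g v)"
  \<comment> \<open>In characteristic 2 the map \<open>y / (y + 1)\<close> is its own inverse. It
    sends the poles 0 and 1 of the summand's argument to 0 and infinity, the poles of a Kloosterman
    argument.\<close>
  proof (rule sum.reindex_bij_witness[where i = "\<lambda>v. v / (v + 1)" and j = "\<lambda>y. y / (y + 1)"])
    have inv: "x / (x + 1) / (x / (x + 1) + 1) = x \<and> x / (x + 1) \<in> UNIV - {0, 1}"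
      if "x \<in> UNIV - {0, 1}" for x :: 'a
    proof -
      have x1: "x + 1 \<noteq> 0" using that add_eq_0_iff_char_2[OF card] by simp
      have "x / (x + 1) + 1 = (x + x + 1) / (x + 1)" using x1 by (simp add: field_simps)
      then have "x / (x + 1) + 1 = 1 / (x + 1)" by (simp only: self add_0)
      then show ?thesis using x1 that by (auto simp: divide_eq_1_iff)
    qed
    fix y :: 'a assume y: "y \<in> UNIV - {0, 1}"
    show "y / (y + 1) / (y / (y + 1) + 1) = y" "y / (y + 1) \<in> UNIV - {0, 1}"
      using inv[OF y] by auto
    show "y / (y + 1) / (y / (y + 1) + 1) = y" "y / (y + 1) \<in> UNIV - {0, 1}"
      using inv[OF y] by auto
    have y0: "y \<noteq> 0" using y by simp
    have y1: "y + 1 \<noteq> 0" using y add_eq_0_iff_char_2[OF card] by simp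
    let ?w = "1 / (y + 1)"
    \<comment> \<open>Partial fractions isolate the double pole. Multiplied by
      \<open>\<xi> ^ 2\<close> it is the square of \<open>\<xi> * ?w\<close>, which the character
      does not distinguish from \<open>\<xi> * ?w\<close> itself.\<close>
    have pf: "1 / (y * (y + 1) ^ 2) = 1 / y + ?w + ?w ^ 2"
    proof -
      have "1 / y + ?w + ?w ^ 2 = ((y + 1) ^ 2 + y * (y + 1) + y) / (y * (y + 1) ^ 2)"
        using y0 y1 by (simp add: divide_simps) (simp add: power2_eq_square algebra_simps)
      also have "(y + 1) ^ 2 + y * (y + 1) + y = (y ^ 2 + y ^ 2) + (y + y) + (y + y) + 1"
        by (simp add: power2_eq_square algebra_simps)
      also have "\<dots> = 1" by (simp add: self)
      finally show ?thesis by simp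
    qed
    have "\<xi> ^ 2 / (y * (y + 1) ^ 2) = \<xi> ^ 2 * (1 / y + ?w + ?w ^ 2)"
      by (simp only: pf[symmetric]) simp
    also have "\<dots> = (\<xi> ^ 2 * (1 / y) + \<xi> ^ 2 * ?w) + (\<xi> * ?w) ^ 2"
      by (simp add: algebra_simps power_mult_distrib power_divide)
    finally have "trace_char m (\<xi> ^ 2 / (y * (y + 1) ^ 2)) =
        trace_char m (\<xi> ^ 2 * (1 / y) + \<xi> ^ 2 * ?w) * trace_char m (\<xi> * ?w)"
      by (simp only: trace_char_add[OF card] trace_char_power2[OF card])
    also have "\<dots> = trace_char m (\<xi> ^ 2 * (1 / y) + \<xi> ^ 2 * ?w + \<xi> * ?w)"
      by (simp only: trace_char_add[OF card])
    \<comment> \<open>In terms of \<open>v = y / (y + 1)\<close> one has \<open>?w = v + 1\<close>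
      and \<open>1 / y = 1 / v + 1\<close>. Of the constants only \<open>\<xi>\<close> survives,
      giving the factor \<open>trace_char m \<xi>\<close>.\<close>
    also have "\<xi> ^ 2 * (1 / y) + \<xi> ^ 2 * ?w + \<xi> * ?w =
        \<xi> + (\<xi> ^ 2 / (y / (y + 1)) + (\<xi> ^ 2 + \<xi>) * (y / (y + 1)))"
    proof -
      have v: "y / (y + 1) = ?w + 1"
      proof -
        have "?w + 1 = (1 + 1 + y) / (y + 1)" using y1 by (simp add: field_simps)
        then show ?thesis by (simp only: self add_0)
      qed
      have v': "\<xi> ^ 2 / (y / (y + 1)) = \<xi> ^ 2 * (1 / y) + \<xi> ^ 2"
        using y0 by (simp add: field_simps)
      have "\<xi> + (\<xi> ^ 2 / (y / (y + 1)) + (\<xi> ^ 2 + \<xi>) * (y / (y + 1))) =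
          (\<xi> ^ 2 * (1 / y) + \<xi> ^ 2 * ?w + \<xi> * ?w) + (\<xi> + \<xi>) + (\<xi> ^ 2 + \<xi> ^ 2)"
        unfolding v' unfolding v by (simp add: algebra_simps)
      then show ?thesis by (simp add: self)
    qed
    finally show "trace_char m \<xi> * ?g (y / (y + 1)) = trace_char m (\<xi> ^ 2 / (y * (y + 1) ^ 2))"
      by (simp only: trace_char_add[OF card])
  qed
  also have "\<dots> = trace_char m \<xi> * ((\<Sum>v\<in>UNIV - {0}. ?g v) - ?g 1)"
  proof -
    have "(\<Sum>v\<in>UNIV - {0}. ?g v) = ?g 1 + (\<Sum>v\<in>UNIV - {0} - {1}. ?g v)"
      by (rule sum.remove) auto
    moreover have "UNIV - {0} - {1} = UNIV - {0, 1 :: 'a}" by auto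
    ultimately show ?thesis by (simp add: sum_distrib_left[symmetric])
  qed
  also have "?g 1 = trace_char m \<xi>"
    by (simp add: add.assoc[symmetric] self)
  \<comment> \<open>The product of the coefficients \<open>\<xi> ^ 2\<close> and
    \<open>\<xi> ^ 2 + \<xi>\<close> is the argument \<open>\<xi> ^ 4 + \<xi> ^ 3\<close>.\<close>
  also have "(\<Sum>v\<in>UNIV - {0}. ?g v) = kloosterman m (\<xi> ^ 4 + \<xi> ^ 3)"
    using kloosterman_rescale[of "\<xi> ^ 2" m "\<xi> ^ 2 + \<xi>"] \<xi>
    by (simp add: algebra_simps numeral_eq_Suc)
  finally show ?thesis
    by (simp add: right_diff_distrib trace_char_mult_self)
qed

text \<open>With \<open>w = y + z + 1\<close> the map is the cyclic shift of
  \<open>(y, z, w)\<close>. A fixed point has all three coordinates equal, hence equal to 1, which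
  forces \<open>c = 1\<close>.\<close>

lemma three_dvd_card_cubic:
  fixes c :: "'a::{field, finite}"
  assumes card: "CARD('a) = 2 ^ m" and "c \<noteq> 1"
  shows "3 dvd card {(y, z). y * z * (y + z + 1) = c}"
proof (rule three_dvd_card_if_no_fixed_point[where f = "\<lambda>(y, z). (z, y + z + 1)"])
  have third: "z + (y + z + 1) + 1 = y" for y z :: 'a
  proof -
    have "z + (y + z + 1) + 1 = y + (z + z) + (1 + 1)" by (simp only: ac_simps)
    then show ?thesis by (simp only: add_self_char_2[OF card] add_0_right)
  qed
  fix p :: "'a \<times> 'a" assume p: "p \<in> {(y, z). y * z * (y + z + 1) = c}"
  obtain y z where [simp]: "p = (y, z)" by (cases p)
  show "(case p of (y, z) \<Rightarrow> (z, y + z + 1)) \<in> {(y, z). y * z * (y + z + 1) = c}"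
    using p by (simp only: \<open>p = (y, z)\<close> mem_Collect_eq prod.case third) (simp add: ac_simps)
  show "(\<lambda>(y, z). (z, y + z + 1)) ((\<lambda>(y, z). (z, y + z + 1)) ((\<lambda>(y, z). (z, y + z + 1)) p)) = p"
    using third[of y z] by (simp only: \<open>p = (y, z)\<close> prod.case third add.commute[of _ y])
  show "(case p of (y, z) \<Rightarrow> (z, y + z + 1)) \<noteq> p"
  proof
    assume "(case p of (y, z) \<Rightarrow> (z, y + z + 1)) = p"
    then have "z = y" "y + z + 1 = z" by auto
    then have "y = 1" "z = 1"
      using add_eq_0_iff_char_2[OF card, of y 1] by (auto simp: add.assoc)
    then have "y * z * (y + z + 1) = 1"
      by (simp only: add_self_char_2[OF card] mult_1 add_0)
    then show False using p assms(2) by simp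
  qed
qed simp

section \<open>Combining the residues modulo 4 and 3\<close>

theorem theorem4:
  fixes m :: nat and b \<xi> :: "'a::{field, finite}"
  assumes "m > 0"
    and "CARD('a) = 2 ^ m"
    and "\<xi> = b ^ 4 + b + 1"
    and "\<xi> \<notin> {0, 1}"
  shows "(odd m \<longrightarrow> [kloosterman m (\<xi> ^ 4 + \<xi> ^ 3) = 3] (mod 12)) \<and>
         (even m \<longrightarrow> [kloosterman m (\<xi> ^ 4 + \<xi> ^ 3) = 7] (mod 12))"
proof -
  note card = assms(2)
  let ?K = "kloosterman m (\<xi> ^ 4 + \<xi> ^ 3)"
  have \<xi>: "\<xi> \<noteq> 0" "\<xi> \<noteq> 1" using assms(4) by auto
  \<comment> \<open>Three distinct elements exclude the field of two elements, so the argument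
    modulo 4 applies.\<close>
  have "card {0, 1, \<xi>} \<le> CARD('a)" by (rule card_mono) auto
  then have "m \<noteq> 1" using \<xi> card by auto
  then have m2: "m \<ge> 2" using assms(1) by simp
  have "\<xi> ^ 4 + \<xi> ^ 3 = \<xi> ^ 3 * (\<xi> + 1)" 
    by (simp add: numeral_eq_Suc distrib_left)
  then have "\<xi> ^ 4 + \<xi> ^ 3 \<noteq> 0" using \<xi> add_eq_0_iff_char_2[OF card] by simp
  then have mod4: "[?K = 3] (mod 4)" by (rule kloosterman_mod_4[OF m2 card])
  \<comment> \<open>The shape of \<open>\<xi>\<close> enters here: \<open>b ^ 4\<close> and
    \<open>b\<close> have the same trace, so their contributions cancel and only that of 1
    remains.\<close>
  have "trace_char m (b ^ 4) = trace_char m ((b ^ 2) ^ 2)" by simp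
  then have "trace_char m (b ^ 4) = trace_char m b"
    by (simp only: trace_char_power2[OF card])
  then have chi: "trace_char m \<xi> = (- 1) ^ m"
    by (simp add: assms(3) trace_char_add[OF card] trace_char_1[OF card] trace_char_mult_self)
  have "\<xi> ^ 2 \<noteq> 1"
    using \<xi>(2) bij_power2_char_2[OF card] by (metis bij_def injD one_power2)
  then have "3 dvd card {(y, z). y * z * (y + z + 1) = \<xi> ^ 2}"
    by (rule three_dvd_card_cubic[OF card])
  then have "int 3 dvd int (card {(y, z). y * z * (y + z + 1) = \<xi> ^ 2})"
    by (simp only: int_dvd_int_iff)
  then have mod3: "3 dvd 2 ^ m - 2 + (- 1) ^ m * ?K"
    by (simp only: card_cubic[OF assms(1) card \<xi>(1)] chi of_nat_numeral)
  \<comment> \<open>As 2 is -1 modulo 3, \<open>mod3\<close> reads \<open>1 - 2 + ?K\<close> for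
    even \<open>m\<close> and \<open>-1 - 2 - ?K\<close> for odd \<open>m\<close>, so
    \<open>?K\<close> is 1 or 0 modulo 3 respectively.\<close>
  have pow: "[2 ^ m = (- 1) ^ m] (mod (3 :: int))"
    by (rule cong_pow) (simp add: cong_def)
  have crt: "[?K = k] (mod 12)" if "[?K = k] (mod 4)" "[?K = k] (mod 3)" for k
    using coprime_cong_mult[OF that] coprime_add_one_left[of "3 :: int"] by simp
  show ?thesis
  proof (cases "even m")
    case True
    with mod3 pow have "[?K = 1] (mod 3)" by (simp add: cong_def) presburger
    with mod4 have "[?K = 7] (mod 12)" by (intro crt) (simp_all add: cong_def)
    with True show ?thesis by simp
  next
    case False
    with mod3 pow have "[?K = 0] (mod 3)" by (simp add: cong_def) presburger
    with mod4 have "[?K = 3] (mod 12)" by (intro crt) (simp_all add: cong_def)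
    with False show ?thesis by simp
  qed
qed

end
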